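(* Let $X$ and $Y$ be compact metric spaces. If $f\colon X\to X$ is a first-time sensitive homeomorphism and $g\colon Y\to Y$ is an equicontinuous homeomorphism, then $f\times g\colon X\times Y\to X\times Y$ is first-time sensitive, where $X\times Y$ carries the product (maximum) metric.
   Context: A homeomorphism $g$ is equicontinuous if the family of iterates $(g^n)_{n\in\mathbb N}$ is equicontinuous. The product metric is $d((x,y),(x',y'))=\max\{d_X(x,x'),d_Y(y,y')\}$. Let $(X,d)$ be a compact metric space and $B(x,r)$ its open balls. A map $f\colon X\to X$ is sensitive if there is $\varepsilon>0$ (a sensitivity constant) such that for every $x\in X$ and every $\delta>0$ there exist $y\in X$ with $d(x,y)<\delta$ and $n\in\mathbb N$ with $d(f^n(x),f^n(y))>\varepsilon$. Any $\gamma\in(0,\varepsilon]$ is then also a sensitivity constant. For a sensitive homeomorphism and a sensitivity constant $\gamma$, the first increasing time $n_1(x,r,\gamma)$ is the first iterate $n\ge 0$ with $\operatorname{diam} f^{n}(B(x,r))>\gamma$. A sensitive homeomorphism $f$ with sensitivity constant $\varepsilon$ is first-time sensitive if there is a sequence of functions $r_k\colon X\to(0,\infty)$, $k\in\mathbb N=\{1,2,\dots\}$, with $r_1$ constant and $(r_k(x))_k$ decreasing monotonically to $0$ for each $x$, such that for each $\gamma\in(0,\varepsilon]$ there is $m_\gamma>0$ satisfying (F1) $|n_1(x,r_{k+1}(x),\gamma)-n_1(x,r_k(x),\gamma)|\leq m_\gamma$ and (F2) $|n_1(x,r_k(x),\gamma)-n_1(x,r_k(x),\varepsilon)|\leq m_\gamma$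 for every $x\in X$ and every $k\in\mathbb N$ with $r_k(x)\leq\gamma$. *)

theory Defs
  imports "HOL-Analysis.Analysis"
begin

context Metric_space
begin

text \<open>The analogue of \<^const>\<open>diameter\<close>, which is restricted to the type class.
  The supremum is only meaningful for bounded sets; below, the space is always compact.\<close>

definition mdiameter :: "'a set \<Rightarrow> real" where
  "mdiameter S = (if S = {} then 0 else SUP (x,y)\<in>S \<times> S. d x y)"

definition self_homeomorphism :: "('a \<Rightarrow> 'a) \<Rightarrow> bool" where
  "self_homeomorphism f \<longleftrightarrow> homeomorphic_map mtopology mtopology f"

definition equicontinuous_homeomorphism :: "('a \<Rightarrow> 'a) \<Rightarrow> bool" where
  "equicontinuous_homeomorphism g \<longleftrightarrow> self_homeomorphism g \<and>
     (\<forall>x\<in>M. \<forall>e>0. \<exists>\<delta>>0. \<forall>y\<in>M. d x y < \<delta> \<longrightarrow> (\<forall>n\<ge>1. d ((g ^^ n) x) ((g ^^ n) y) < e))"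

definition sensitivity_constant :: "('a \<Rightarrow> 'a) \<Rightarrow> real \<Rightarrow> bool" where
  "sensitivity_constant f \<epsilon> \<longleftrightarrow> \<epsilon> > 0 \<and>
     (\<forall>x\<in>M. \<forall>\<delta>>0. \<exists>y\<in>M. d x y < \<delta> \<and> (\<exists>n\<ge>1. d ((f ^^ n) x) ((f ^^ n) y) > \<epsilon>))"

text \<open>The set of such times is nonempty whenever \<open>\<gamma>\<close> is a sensitivity constant of \<open>f\<close>,
  \<open>x \<in> M\<close> and \<open>r > 0\<close> (and \<open>M\<close> is compact), so that \<open>LEAST\<close> is then meaningful.\<close>

definition first_increasing_time :: "('a \<Rightarrow> 'a) \<Rightarrow> 'a \<Rightarrow> real \<Rightarrow> real \<Rightarrow> nat" where
  "first_increasing_time f x r \<gamma> = (LEAST n. mdiameter ((f ^^ n) ` mball x r) > \<gamma>)"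

text \<open>The sequence \<open>r\<close> is indexed from \<open>1\<close>; the value \<open>r 0\<close> is irrelevant.
  ``Decreasing'' is understood in the weak sense.\<close>

definition first_time_sensitive :: "('a \<Rightarrow> 'a) \<Rightarrow> bool" where
  "first_time_sensitive f \<longleftrightarrow> self_homeomorphism f \<and>
     (\<exists>\<epsilon>. sensitivity_constant f \<epsilon> \<and>
       (\<exists>r :: nat \<Rightarrow> 'a \<Rightarrow> real.
          (\<forall>k\<ge>1. \<forall>x\<in>M. r k x > 0) \<and>
          (\<exists>c. \<forall>x\<in>M. r 1 x = c) \<and>
          (\<forall>x\<in>M. (\<forall>k\<ge>1. r (k + 1) x \<le> r k x) \<and> (\<lambda>k. r k x) \<longlonglongrightarrow> 0) \<and>
          (\<forall>\<gamma>. 0 < \<gamma> \<and> \<gamma> \<le> \<epsilon> \<longrightarrow>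
            (\<exists>m::real. m > 0 \<and>
              (\<forall>x\<in>M. \<forall>k\<ge>1. r k x \<le> \<gamma> \<longrightarrow>
                 \<bar>real (first_increasing_time f x (r (k + 1) x) \<gamma>)
                   - real (first_increasing_time f x (r k x) \<gamma>)\<bar> \<le> m \<and>
                 \<bar>real (first_increasing_time f x (r k x) \<gamma>)
                   - real (first_increasing_time f x (r k x) \<epsilon>)\<bar> \<le> m)))))"

end

text \<open>The library's \<^const>\<open>prod_dist\<close> is the Euclidean product metric, not the maximum metric.\<close>

definition max_dist ::
    "('a \<Rightarrow> 'a \<Rightarrow> real) \<Rightarrow> ('b \<Rightarrow> 'b \<Rightarrow> real) \<Rightarrow> 'a \<times> 'b \<Rightarrow> 'a \<times> 'b \<Rightarrow> real" where
  "max_dist d1 d2 = (\<lambda>(x,y) (x',y'). max (d1 x x') (d2 y y'))"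

lemma (in Metric_space12) Metric_space_max_dist: "Metric_space (M1 \<times> M2) (max_dist d1 d2)"
proof
  fix p q s
  show "0 \<le> max_dist d1 d2 p q"
    by (auto simp: max_dist_def le_max_iff_disj split: prod.splits)
  show "max_dist d1 d2 p q = max_dist d1 d2 q p"
    by (auto simp: max_dist_def M1.commute M2.commute split: prod.splits)
  assume p: "p \<in> M1 \<times> M2" and q: "q \<in> M1 \<times> M2"
  obtain a b where ab: "p = (a,b)" "a \<in> M1" "b \<in> M2" using p by auto
  obtain a' b' where ab': "q = (a',b')" "a' \<in> M1" "b' \<in> M2" using q by auto
  show "max_dist d1 d2 p q = 0 \<longleftrightarrow> p = q"
  proof -
    have "d1 a a' \<le> 0 \<longleftrightarrow> a = a'" "d2 b b' \<le> 0 \<longleftrightarrow> b = b'"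
      using ab ab' M1.mdist_pos_eq[of a a'] M2.mdist_pos_eq[of b b'] by (auto simp: not_less[symmetric])
    moreover have "max (d1 a a') (d2 b b') = 0 \<longleftrightarrow> d1 a a' \<le> 0 \<and> d2 b b' \<le> 0"
      using M1.nonneg[of a a'] M2.nonneg[of b b'] by linarith
    ultimately show ?thesis using ab ab' by (simp add: max_dist_def)
  qed
  assume s: "s \<in> M1 \<times> M2"
  obtain u v where uv: "s = (u,v)" "u \<in> M1" "v \<in> M2" using s by auto
  show "max_dist d1 d2 p s \<le> max_dist d1 d2 p q + max_dist d1 d2 q s"
    using M1.triangle[of a a' u] M2.triangle[of b b' v] ab ab' uv
    by (auto simp: max_dist_def)
qed

lemma (in Metric_space12) mtopology_max_dist:
  "Metric_space.mtopology (M1 \<times> M2) (max_dist d1 d2)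
     = prod_topology M1.mtopology M2.mtopology"
proof -
  interpret P: Metric_space "M1 \<times> M2" "max_dist d1 d2"
    by (rule Metric_space_max_dist)
  have le: "max_dist d1 d2 p q \<le> prod_dist d1 d2 p q" for p q
    using component_le_prod_metric by (cases p; cases q) (auto simp: max_dist_def)
  have ge: "prod_dist d1 d2 p q \<le> 2 * max_dist d1 d2 p q"
    if "p \<in> M1 \<times> M2" "q \<in> M1 \<times> M2" for p q
  proof -
    obtain a b a' b' where pq: "p = (a,b)" "q = (a',b')" by fastforce
    with that have "prod_dist d1 d2 p q \<le> d1 a a' + d2 b b'"
      using prod_metric_le_components by auto
    then show ?thesis using pq by (simp add: max_dist_def)
  qed
  have sub1: "Prod_metric.mball p r \<subseteq> P.mball p r" for p r
  proof
    fix q assume "q \<in> Prod_metric.mball p r"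
    then show "q \<in> P.mball p r"
      using le[of p q] unfolding Prod_metric.in_mball P.in_mball by linarith
  qed
  have sub2: "P.mball p (r/2) \<subseteq> Prod_metric.mball p r" for p r
  proof
    fix q assume "q \<in> P.mball p (r/2)"
    then show "q \<in> Prod_metric.mball p r"
      using ge[of p q] unfolding Prod_metric.in_mball P.in_mball by linarith
  qed
  have "openin P.mtopology U \<longleftrightarrow> openin Prod_metric.mtopology U" for U
    unfolding P.openin_mtopology Prod_metric.openin_mtopology
    using sub1 sub2 by (meson half_gt_zero order_trans)
  then show ?thesis
    using mtopology_prod_metric by (simp add: topology_eq)
qed

end

theory Submission
  imports Defs
begin

text \<open>
  The product system inherits the constant \<open>\<epsilon>\<close> and the radii \<open>r k x\<close> of the first factor, read
  as functions of \<open>(x, y)\<close>.  For the maximum metric, a ball is a product of balls, so an iterate of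
  the ball of radius \<open>s\<close> at \<open>(x, y)\<close> has diameter greater than \<open>\<gamma>\<close> exactly if one of its two
  projections has.  Hence the first increasing time of the product never exceeds that of \<open>f\<close>
  (\<open>first_increasing_time_prod_le\<close>).

  Fix \<open>\<gamma> \<le> \<epsilon>\<close>.  Equicontinuity is uniform on a compact space, so there is a \<open>\<delta> > 0\<close> such that no
  iterate of \<open>g\<close> expands a ball of radius at most \<open>\<delta>\<close> beyond diameter \<open>\<gamma>\<close>.  At such radii, the
  first increasing times of the product and of \<open>f\<close> coincide, both for \<open>\<gamma>\<close> and for \<open>\<epsilon>\<close>, and the
  estimates for \<open>f\<close> carry over unchanged.  At radii above \<open>\<delta>\<close> the second factor may expand first, and
  the times can differ.  They are harmless nevertheless: by compactness, the first increasing times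
  of \<open>f\<close> at radii above \<open>\<delta>\<close> are bounded by some \<open>N\<close> uniformly in \<open>x\<close>
  (\<open>first_increasing_time_bounded\<close>), and the estimates for \<open>f\<close> then bound by \<open>N + m\<close> all the times
  of \<open>f\<close> being compared, hence also those of the product.  So \<open>N + m\<close> serves as the new bound.
\<close>

section \<open>First increasing times on a compact metric space\<close>

lemma (in Metric_space) mdiameter_gt_iff:
  assumes "mbounded S" "0 \<le> \<gamma>"
  shows "mdiameter S > \<gamma> \<longleftrightarrow> (\<exists>x\<in>S. \<exists>y\<in>S. d x y > \<gamma>)"
proof (cases "S = {}")
  case False
  obtain B where "\<forall>x\<in>S. \<forall>y\<in>S. d x y \<le> B"
    using \<open>mbounded S\<close> unfolding mbounded_alt by blast
  then have "bdd_above ((\<lambda>(x, y). d x y) ` (S \<times> S))"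
    by (auto intro!: bdd_aboveI[where M = B])
  then show ?thesis
    using False by (simp add: mdiameter_def less_cSUP_iff Bex_def)
qed (use assms in \<open>simp add: mdiameter_def\<close>)

lemma self_homeomorphism_funpow_in:
  assumes "Metric_space M d" "Metric_space.self_homeomorphism M d f" "x \<in> M"
  shows "(f ^^ n) x \<in> M"
proof -
  interpret Metric_space M d by fact
  have "f ` M = M"
    using assms(2) homeomorphic_imp_surjective_map unfolding self_homeomorphism_def by fastforce
  then show ?thesis
    using \<open>x \<in> M\<close> by (induction n) auto
qed

definition (in Metric_space) expanded_at :: "('a \<Rightarrow> 'a) \<Rightarrow> 'a \<Rightarrow> real \<Rightarrow> real \<Rightarrow> nat \<Rightarrow> bool" where
  "expanded_at f x r \<gamma> n \<longleftrightarrow>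
     (\<exists>u\<in>mball x r. \<exists>v\<in>mball x r. d ((f ^^ n) u) ((f ^^ n) v) > \<gamma>)"

text \<open>Compactness turns the supremum in the diameter into the existence of two separated points,
  which is the form that splits over products.\<close>

lemma (in Metric_space) first_increasing_time_eq_Least_expanded:
  assumes "compact_space mtopology" "self_homeomorphism f" "0 \<le> \<gamma>"
  shows "first_increasing_time f x r \<gamma> = (LEAST n. expanded_at f x r \<gamma> n)"
proof -
  have "mbounded ((f ^^ n) ` mball x r)" for n
  proof (rule mbounded_subset)
    show "mbounded M"
      using assms(1) compactin_imp_mbounded by (simp add: compact_space_def)
    show "(f ^^ n) ` mball x r \<subseteq> M"
      using self_homeomorphism_funpow_in[OF Metric_space_axioms assms(2)] by auto
  qed
  then show ?thesis
    using \<open>0 \<le> \<gamma>\<close> by (simp add: first_increasing_time_def expanded_at_def mdiameter_gt_iff)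
qed

lemma (in Metric_space) sensitive_imp_expanded_at:
  assumes "sensitivity_constant f \<epsilon>" "\<gamma> \<le> \<epsilon>" "x \<in> M" "r > 0"
  shows "\<exists>n. expanded_at f x r \<gamma> n"
proof -
  obtain y n where "y \<in> M" "d x y < r" "d ((f ^^ n) x) ((f ^^ n) y) > \<epsilon>"
    using assms unfolding sensitivity_constant_def by blast
  then show ?thesis
    using assms by (intro exI[of _ n]) (force simp: expanded_at_def)
qed

text \<open>Every ball of radius at least \<open>\<delta>\<close> contains the ball of radius \<open>\<delta> / 2\<close> around any point within
  \<open>\<delta> / 2\<close> of its centre, so the times at a finite \<open>\<delta> / 2\<close>-net bound those at all points.\<close>

lemma (in Metric_space) first_increasing_time_bounded:
  assumes "compact_space mtopology" "self_homeomorphism f" "sensitivity_constant f \<epsilon>"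
    and "0 \<le> \<gamma>" "\<gamma> \<le> \<epsilon>" "\<delta> > 0"
  shows "\<exists>N. \<forall>x\<in>M. \<forall>r\<ge>\<delta>. first_increasing_time f x r \<gamma> \<le> N"
proof -
  have "mtotally_bounded M"
    using assms(1) compactin_imp_mtotally_bounded by (simp add: compact_space_def)
  then obtain K where K: "finite K" "K \<subseteq> M" "M \<subseteq> (\<Union>z\<in>K. mball z (\<delta> / 2))"
    using \<open>\<delta> > 0\<close> unfolding mtotally_bounded_def by (meson half_gt_zero)
  have "\<forall>z\<in>K. \<exists>n. expanded_at f z (\<delta> / 2) \<gamma> n"
    using sensitive_imp_expanded_at[OF assms(3,5)] K(2) \<open>\<delta> > 0\<close> by (meson half_gt_zero subsetD)
  then obtain t where t: "\<And>z. z \<in> K \<Longrightarrow> expanded_at f z (\<delta> / 2) \<gamma> (t z)"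
    by metis
  have "first_increasing_time f x r \<gamma> \<le> Max (t ` K)" if "x \<in> M" "r \<ge> \<delta>" for x r
  proof -
    obtain z where z: "z \<in> K" "x \<in> mball z (\<delta> / 2)"
      using K(3) \<open>x \<in> M\<close> by blast
    have "mball z (\<delta> / 2) \<subseteq> mball x r"
      using z(2) \<open>r \<ge> \<delta>\<close> by (intro mball_subset) (auto simp: commute)
    then have "expanded_at f x r \<gamma> (t z)"
      using t[OF z(1)] unfolding expanded_at_def by blast
    then have "first_increasing_time f x r \<gamma> \<le> t z"
      unfolding first_increasing_time_eq_Least_expanded[OF assms(1,2,4)] by (rule Least_le)
    also have "\<dots> \<le> Max (t ` K)"
      using K(1) z(1) by simp
    finally show ?thesis .
  qed
  then show ?thesis by blast
qed

text \<open>The radius comes from a Lebesgue number of the cover by balls on which the iterates stay within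
  \<open>\<gamma> / 2\<close> of the orbit of the centre.\<close>

lemma (in Metric_space) equicontinuous_imp_uniformly_not_expanded:
  assumes "compact_space mtopology" "equicontinuous_homeomorphism g" "\<gamma> > 0"
  shows "\<exists>\<delta>>0. \<forall>y\<in>M. \<forall>r\<le>\<delta>. \<forall>n. \<not> expanded_at g y r \<gamma> n"
proof -
  have "\<exists>s>0. \<forall>z\<in>M. d y z < s \<longrightarrow> (\<forall>n. d ((g ^^ n) y) ((g ^^ n) z) < \<gamma> / 2)" if "y \<in> M" for y
  proof -
    obtain s where s: "s > 0"
      "\<And>z n. z \<in> M \<Longrightarrow> d y z < s \<Longrightarrow> n \<ge> 1 \<Longrightarrow> d ((g ^^ n) y) ((g ^^ n) z) < \<gamma> / 2"
      using assms(2,3) \<open>y \<in> M\<close> unfolding equicontinuous_homeomorphism_def by (meson half_gt_zero)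
    \<comment> \<open>Equicontinuity speaks of positive iterates only; the minimum takes care of the time \<open>0\<close>.\<close>
    have "d ((g ^^ n) y) ((g ^^ n) z) < \<gamma> / 2" if "z \<in> M" "d y z < min s (\<gamma> / 2)" for z n
      using s(2)[of z n] that by (cases n) auto
    then show ?thesis
      using s(1) \<open>\<gamma> > 0\<close> by (intro exI[of _ "min s (\<gamma> / 2)"]) auto
  qed
  then obtain s where s: "\<And>y. y \<in> M \<Longrightarrow> s y > 0"
      "\<And>y z n. y \<in> M \<Longrightarrow> z \<in> M \<Longrightarrow> d y z < s y \<Longrightarrow> d ((g ^^ n) y) ((g ^^ n) z) < \<gamma> / 2"
    by metis
  have "M \<subseteq> \<Union> ((\<lambda>y. mball y (s y)) ` M)"
    using s(1) by force
  then obtain \<delta> where \<delta>: "\<delta> > 0" "\<And>y. y \<in> M \<Longrightarrow> \<exists>c\<in>M. mball y \<delta> \<subseteq> mball c (s c)"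
    using lebesgue_number[of M "(\<lambda>y. mball y (s y)) ` M"] assms(1)
    by (force simp: compact_space_def)
  have g_in: "(g ^^ n) z \<in> M" if "z \<in> M" for z n
    using self_homeomorphism_funpow_in[OF Metric_space_axioms _ that] assms(2)
    by (simp add: equicontinuous_homeomorphism_def)
  have "d ((g ^^ n) u) ((g ^^ n) v) \<le> \<gamma>"
    if y: "y \<in> M" and r: "r \<le> \<delta>" and uv: "u \<in> mball y r" "v \<in> mball y r" for y r n u v
  proof -
    obtain c where c: "c \<in> M" "mball y \<delta> \<subseteq> mball c (s c)"
      using \<delta>(2)[OF y] by blast
    have "u \<in> mball c (s c)" "v \<in> mball c (s c)"
      using c(2) uv mball_subset_concentric[OF r] by blast+
    then have "d ((g ^^ n) c) ((g ^^ n) u) < \<gamma> / 2" "d ((g ^^ n) c) ((g ^^ n) v) < \<gamma> / 2"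
        "u \<in> M" "v \<in> M"
      using s(2) c(1) by auto
    then show ?thesis
      using triangle''[OF g_in[of u n] g_in[of c n] g_in[of v n]] c(1) by simp
  qed
  then show ?thesis
    using \<delta>(1) unfolding expanded_at_def by (meson not_le)
qed

section \<open>Products with the maximum metric\<close>

locale Metric_space_max = Metric_space12 +
  assumes compact1: "compact_space M1.mtopology" and compact2: "compact_space M2.mtopology"
begin

sublocale Max: Metric_space "M1 \<times> M2" "max_dist d1 d2"
  by (rule Metric_space_max_dist)

lemma compact_Max: "compact_space Max.mtopology"
  using compact1 compact2 by (simp add: mtopology_max_dist compact_space_prod_topology)

lemma self_homeomorphism_map_prod:
  assumes "M1.self_homeomorphism f" "M2.self_homeomorphism g"
  shows "Max.self_homeomorphism (map_prod f g)"
proof -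
  obtain f' g' where "homeomorphic_maps M1.mtopology M1.mtopology f f'"
      "homeomorphic_maps M2.mtopology M2.mtopology g g'"
    using assms unfolding M1.self_homeomorphism_def M2.self_homeomorphism_def homeomorphic_map_maps
    by blast
  then have "homeomorphic_maps Max.mtopology Max.mtopology
      (\<lambda>(x, y). (f x, g y)) (\<lambda>(x, y). (f' x, g' y))"
    unfolding mtopology_max_dist homeomorphic_maps_prod by blast
  then show ?thesis
    unfolding Max.self_homeomorphism_def homeomorphic_map_maps map_prod_def by blast
qed

lemma mball_max_dist: "Max.mball (x, y) r = M1.mball x r \<times> M2.mball y r"
proof (rule set_eqI)
  fix p show "p \<in> Max.mball (x, y) r \<longleftrightarrow> p \<in> M1.mball x r \<times> M2.mball y r"
    unfolding Max.in_mball by (cases p) (auto simp: max_dist_def)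
qed

lemma map_prod_funpow:
  fixes f :: "'c \<Rightarrow> 'c" and g :: "'d \<Rightarrow> 'd"
  shows "(map_prod f g ^^ n) (u, v) = ((f ^^ n) u, (g ^^ n) v)"
  by (induction n) auto

lemma expanded_at_map_prod:
  assumes "x \<in> M1" "y \<in> M2" "r > 0"
  shows "Max.expanded_at (map_prod f g) (x, y) r \<gamma> n \<longleftrightarrow>
    M1.expanded_at f x r \<gamma> n \<or> M2.expanded_at g y r \<gamma> n"
proof -
  have "x \<in> M1.mball x r" "y \<in> M2.mball y r"
    using assms by auto
  then show ?thesis
    unfolding Max.expanded_at_def M1.expanded_at_def M2.expanded_at_def mball_max_dist
    by (force simp: map_prod_funpow max_dist_def less_max_iff_disj)
qed

lemma sensitivity_constant_map_prod:
  assumes "M1.sensitivity_constant f \<epsilon>"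
  shows "Max.sensitivity_constant (map_prod f g) \<epsilon>"
  unfolding Max.sensitivity_constant_def
proof (intro conjI ballI allI impI)
  show "\<epsilon> > 0"
    using assms by (simp add: M1.sensitivity_constant_def)
  fix p and \<delta> :: real assume "p \<in> M1 \<times> M2" "\<delta> > 0"
  then obtain x y where p: "p = (x, y)" "x \<in> M1" "y \<in> M2" by auto
  obtain x' n where "x' \<in> M1" "d1 x x' < \<delta>" "n \<ge> 1" "d1 ((f ^^ n) x) ((f ^^ n) x') > \<epsilon>"
    using assms p(2) \<open>\<delta> > 0\<close> unfolding M1.sensitivity_constant_def by blast
  then show "\<exists>q\<in>M1 \<times> M2. max_dist d1 d2 p q < \<delta> \<and>
      (\<exists>n\<ge>1. max_dist d1 d2 ((map_prod f g ^^ n) p) ((map_prod f g ^^ n) q) > \<epsilon>)"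
    using p \<open>\<delta> > 0\<close>
    by (intro bexI[of _ "(x', y)"] conjI exI[of _ n])
      (auto simp: map_prod_funpow max_dist_def less_max_iff_disj)
qed

section \<open>First-time sensitivity of products\<close>

context
  fixes f :: "'a \<Rightarrow> 'a" and g :: "'b \<Rightarrow> 'b" and \<epsilon> \<gamma> r :: real and x :: 'a and y :: 'b
  assumes homeo: "M1.self_homeomorphism f" "M2.self_homeomorphism g"
    and sens: "M1.sensitivity_constant f \<epsilon>"
    and \<gamma>: "0 \<le> \<gamma>" "\<gamma> \<le> \<epsilon>"
    and xy: "x \<in> M1" "y \<in> M2" and r: "r > 0"
begin

lemma first_increasing_time_prod_le:
  "Max.first_increasing_time (map_prod f g) (x, y) r \<gamma> \<le> M1.first_increasing_time f x r \<gamma>"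
proof -
  have "M1.expanded_at f x r \<gamma> (LEAST n. M1.expanded_at f x r \<gamma> n)"
    using M1.sensitive_imp_expanded_at[OF sens \<gamma>(2) xy(1) r] by (rule LeastI_ex)
  then show ?thesis
    unfolding M1.first_increasing_time_eq_Least_expanded[OF compact1 homeo(1) \<gamma>(1)]
      Max.first_increasing_time_eq_Least_expanded
        [OF compact_Max self_homeomorphism_map_prod[OF homeo] \<gamma>(1)]
    by (intro Least_le) (simp add: expanded_at_map_prod[OF xy r])
qed

lemma first_increasing_time_prod_eq:
  assumes "\<And>n. \<not> M2.expanded_at g y r \<gamma> n"
  shows "Max.first_increasing_time (map_prod f g) (x, y) r \<gamma> = M1.first_increasing_time f x r \<gamma>"
  using assms
  unfolding M1.first_increasing_time_eq_Least_expanded[OF compact1 homeo(1) \<gamma>(1)]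
      Max.first_increasing_time_eq_Least_expanded
        [OF compact_Max self_homeomorphism_map_prod[OF homeo] \<gamma>(1)]
  by (intro arg_cong[where f = Least] ext) (simp add: expanded_at_map_prod[OF xy r])

end

text \<open>If \<open>m\<close> bounds the two differences for \<open>f\<close>, then \<open>N + m\<close> bounds those for the product, where
  \<open>N\<close> bounds the first increasing times of \<open>f\<close> at the radii that are too large for equicontinuity of
  \<open>g\<close> to control the second factor.\<close>

lemma first_increasing_time_prod_differences:
  fixes r :: "nat \<Rightarrow> 'a \<Rightarrow> real" and m :: real
  assumes homeo: "M1.self_homeomorphism f" and equi: "M2.equicontinuous_homeomorphism g"
    and sens: "M1.sensitivity_constant f \<epsilon>" and \<gamma>: "0 < \<gamma>" "\<gamma> \<le> \<epsilon>"
    and pos: "\<forall>k\<ge>1. \<forall>x\<in>M1. r k x > 0" and decr: "\<forall>x\<in>M1. \<forall>k\<ge>1. r (k + 1) x \<le> r k x"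
    and "m > 0"
    and times: "\<forall>x\<in>M1. \<forall>k\<ge>1. r k x \<le> \<gamma> \<longrightarrow>
         \<bar>real (M1.first_increasing_time f x (r (k + 1) x) \<gamma>)
           - real (M1.first_increasing_time f x (r k x) \<gamma>)\<bar> \<le> m \<and>
         \<bar>real (M1.first_increasing_time f x (r k x) \<gamma>)
           - real (M1.first_increasing_time f x (r k x) \<epsilon>)\<bar> \<le> m"
  shows "\<exists>m::real. m > 0 \<and> (\<forall>p\<in>M1 \<times> M2. \<forall>k\<ge>1. r k (fst p) \<le> \<gamma> \<longrightarrow>
         \<bar>real (Max.first_increasing_time (map_prod f g) p (r (k + 1) (fst p)) \<gamma>)
           - real (Max.first_increasing_time (map_prod f g) p (r k (fst p)) \<gamma>)\<bar> \<le> m \<and>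
         \<bar>real (Max.first_increasing_time (map_prod f g) p (r k (fst p)) \<gamma>)
           - real (Max.first_increasing_time (map_prod f g) p (r k (fst p)) \<epsilon>)\<bar> \<le> m)"
proof -
  have homeo_g: "M2.self_homeomorphism g"
    using equi by (simp add: M2.equicontinuous_homeomorphism_def)
  have nonneg: "0 \<le> \<gamma>" "0 \<le> \<epsilon>"
    using \<gamma> by auto
  obtain \<delta> where \<delta>: "\<delta> > 0" "\<And>y r n. y \<in> M2 \<Longrightarrow> r \<le> \<delta> \<Longrightarrow> \<not> M2.expanded_at g y r \<gamma> n"
    using M2.equicontinuous_imp_uniformly_not_expanded[OF compact2 equi \<gamma>(1)] by blast
  \<comment> \<open>Exceeding \<open>\<epsilon>\<close> entails exceeding \<open>\<gamma>\<close>, so the same radius works for both thresholds.\<close>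
  have \<delta>_\<epsilon>: "\<not> M2.expanded_at g y r \<epsilon> n" if "y \<in> M2" "r \<le> \<delta>" for y r n
    using \<delta>(2)[OF that, of n] \<gamma>(2) unfolding M2.expanded_at_def by force
  obtain N where N: "\<And>x r. x \<in> M1 \<Longrightarrow> r \<ge> \<delta> \<Longrightarrow> M1.first_increasing_time f x r \<gamma> \<le> N"
    using M1.first_increasing_time_bounded[OF compact1 homeo sens nonneg(1) \<gamma>(2) \<delta>(1)] by blast
  note le = first_increasing_time_prod_le[OF homeo homeo_g sens]
  note eq = first_increasing_time_prod_eq[OF homeo homeo_g sens]
  have "\<bar>real (Max.first_increasing_time (map_prod f g) (x, y) (r (k + 1) x) \<gamma>)
        - real (Max.first_increasing_time (map_prod f g) (x, y) (r k x) \<gamma>)\<bar> \<le> N + m \<and>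
      \<bar>real (Max.first_increasing_time (map_prod f g) (x, y) (r k x) \<gamma>)
        - real (Max.first_increasing_time (map_prod f g) (x, y) (r k x) \<epsilon>)\<bar> \<le> N + m"
    if xy: "x \<in> M1" "y \<in> M2" and k: "k \<ge> 1" "r k x \<le> \<gamma>" for x y k
  proof -
    let ?F = "M1.first_increasing_time f x"
      and ?P = "Max.first_increasing_time (map_prod f g) (x, y)"
      and ?s = "r (k + 1) x" and ?r = "r k x"
    have sr: "0 < ?s" "?s \<le> ?r" "0 < ?r"
      using pos decr xy(1) k(1) by auto
    have F: "\<bar>real (?F ?s \<gamma>) - real (?F ?r \<gamma>)\<bar> \<le> m" "\<bar>real (?F ?r \<gamma>) - real (?F ?r \<epsilon>)\<bar> \<le> m"
      using times xy(1) k by blast+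
    show ?thesis
    proof (cases "?r \<le> \<delta>")
      case True
      then have "?s \<le> \<delta>"
        using sr(2) by simp
      have "?P ?s \<gamma> = ?F ?s \<gamma>"
        by (rule eq[OF nonneg(1) \<gamma>(2) xy sr(1) \<delta>(2)[OF xy(2) \<open>?s \<le> \<delta>\<close>]])
      moreover have "?P ?r \<gamma> = ?F ?r \<gamma>"
        by (rule eq[OF nonneg(1) \<gamma>(2) xy sr(3) \<delta>(2)[OF xy(2) True]])
      moreover have "?P ?r \<epsilon> = ?F ?r \<epsilon>"
        by (rule eq[OF nonneg(2) order_refl xy sr(3) \<delta>_\<epsilon>[OF xy(2) True]])
      ultimately show ?thesis
        using F by simp
    next
      case False
      \<comment> \<open>All six times lie between \<open>0\<close> and \<open>N + m\<close>.\<close>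
      have "?F ?r \<gamma> \<le> N"
        using N[OF xy(1)] False by simp
      moreover have "?P ?s \<gamma> \<le> ?F ?s \<gamma>"
        by (rule le[OF nonneg(1) \<gamma>(2) xy sr(1)])
      moreover have "?P ?r \<gamma> \<le> ?F ?r \<gamma>"
        by (rule le[OF nonneg(1) \<gamma>(2) xy sr(3)])
      moreover have "?P ?r \<epsilon> \<le> ?F ?r \<epsilon>"
        by (rule le[OF nonneg(2) order_refl xy sr(3)])
      ultimately show ?thesis
        using F by linarith
    qed
  qed
  then show ?thesis
    using \<open>m > 0\<close> by (intro exI[of _ "N + m"]) auto
qed

lemma first_time_sensitive_map_prod:
  assumes f: "M1.first_time_sensitive f" and g: "M2.equicontinuous_homeomorphism g"
  shows "Max.first_time_sensitive (map_prod f g)"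
proof -
  have homeo: "M1.self_homeomorphism f" "M2.self_homeomorphism g"
    using f g by (simp_all add: M1.first_time_sensitive_def M2.equicontinuous_homeomorphism_def)
  obtain \<epsilon> and r :: "nat \<Rightarrow> 'a \<Rightarrow> real" where sens: "M1.sensitivity_constant f \<epsilon>"
    and pos: "\<forall>k\<ge>1. \<forall>x\<in>M1. r k x > 0"
    and const: "\<exists>c. \<forall>x\<in>M1. r 1 x = c"
    and decr: "\<forall>x\<in>M1. (\<forall>k\<ge>1. r (k + 1) x \<le> r k x) \<and> (\<lambda>k. r k x) \<longlonglongrightarrow> 0"
    and times: "\<forall>\<gamma>. 0 < \<gamma> \<and> \<gamma> \<le> \<epsilon> \<longrightarrow> (\<exists>m::real. m > 0 \<and>
      (\<forall>x\<in>M1. \<forall>k\<ge>1. r k x \<le> \<gamma> \<longrightarrow>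
         \<bar>real (M1.first_increasing_time f x (r (k + 1) x) \<gamma>)
           - real (M1.first_increasing_time f x (r k x) \<gamma>)\<bar> \<le> m \<and>
         \<bar>real (M1.first_increasing_time f x (r k x) \<gamma>)
           - real (M1.first_increasing_time f x (r k x) \<epsilon>)\<bar> \<le> m))"
    using f unfolding M1.first_time_sensitive_def
    by (elim conjE exE) (rule that; (assumption | rule exI, assumption))
  show ?thesis
    unfolding Max.first_time_sensitive_def
  proof (rule conjI[OF self_homeomorphism_map_prod[OF homeo]],
      rule exI[of _ \<epsilon>], rule conjI[OF sensitivity_constant_map_prod[OF sens]],
      rule exI[of _ "\<lambda>k p. r k (fst p)"], intro conjI allI impI)
    show "\<forall>p\<in>M1 \<times> M2. r k (fst p) > 0" if "k \<ge> 1" for k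
      using pos that by auto
    show "\<exists>c. \<forall>p\<in>M1 \<times> M2. r 1 (fst p) = c"
      using const by auto
    show "\<forall>p\<in>M1 \<times> M2. (\<forall>k\<ge>1. r (k + 1) (fst p) \<le> r k (fst p)) \<and> (\<lambda>k. r k (fst p)) \<longlonglongrightarrow> 0"
      using decr by auto
  next
    fix \<gamma> assume \<gamma>: "0 < \<gamma> \<and> \<gamma> \<le> \<epsilon>"
    show "\<exists>m::real. m > 0 \<and> (\<forall>p\<in>M1 \<times> M2. \<forall>k\<ge>1. r k (fst p) \<le> \<gamma> \<longrightarrow>
         \<bar>real (Max.first_increasing_time (map_prod f g) p (r (k + 1) (fst p)) \<gamma>)
           - real (Max.first_increasing_time (map_prod f g) p (r k (fst p)) \<gamma>)\<bar> \<le> m \<and>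
         \<bar>real (Max.first_increasing_time (map_prod f g) p (r k (fst p)) \<gamma>)
           - real (Max.first_increasing_time (map_prod f g) p (r k (fst p)) \<epsilon>)\<bar> \<le> m)"
      using times[THEN spec, THEN mp, OF \<gamma>] decr \<gamma>
      by (elim exE conjE) (rule first_increasing_time_prod_differences[OF homeo(1) g sens _ _ pos], auto)
  qed
qed

end

theorem proposition3p15:
  fixes X :: "'a set" and dX :: "'a \<Rightarrow> 'a \<Rightarrow> real"
    and Y :: "'b set" and dY :: "'b \<Rightarrow> 'b \<Rightarrow> real"
    and f :: "'a \<Rightarrow> 'a" and g :: "'b \<Rightarrow> 'b"
  assumes "Metric_space X dX" and "compact_space (Metric_space.mtopology X dX)"
    and "Metric_space Y dY" and "compact_space (Metric_space.mtopology Y dY)"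
    and "Metric_space.first_time_sensitive X dX f"
    and "Metric_space.equicontinuous_homeomorphism Y dY g"
  shows "Metric_space.first_time_sensitive (X \<times> Y) (max_dist dX dY) (map_prod f g)"
proof -
  interpret Metric_space_max X dX Y dY
    using assms(1-4)
    by (simp add: Metric_space_max_def Metric_space12_def Metric_space_max_axioms_def)
  show ?thesis
    using assms(5,6) by (rule first_time_sensitive_map_prod)
qed

end
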